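(* For every integer $d\ge 2$ and every constant $C>0$ there is a constant $c>0$ such that for infinitely many positive integers $n$ there exist an $n$-vertex directed unweighted graph $G=(V,E)$ with $m=|E|$ edges and a set $S\subseteq V$ with $|S|=\widetilde{\Theta}(n^{3/(d+3)})$ such that for every shortcut set $H$ of $G$ with $|H|\le Cn$, and also for every shortcut set $H$ of $G$ with $|H|\le Cm$, the sourcewise diameter of $G\cup H$ with respect to $S$ is at least $c\,n^{1/(d+3)}$.
   Context: For a directed graph $G=(V,E)$, a shortcut set is a set $H$ of ordered pairs $(u,v)$ of distinct vertices such that $v$ is reachable from $u$ in $G$; $G\cup H$ denotes $(V,E\cup H)$. For $S\subseteq V$, the sourcewise diameter of a directed graph with respect to $S$ is $\max\mathrm{dist}(s,v)$ over all $(s,v)\in S\times V$ with $v$ reachable from $s$, where $\mathrm{dist}$ is the unweighted shortest-path distance. $|S|=\widetilde{\Theta}(n^{3/(d+3)})$ means $|S|$ lies between $n^{3/(d+3)}/\mathrm{polylog}(n)$ and $n^{3/(d+3)}\cdot\mathrm{polylog}(n)$. *)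

theory Defs
  imports "Graph_Theory.Graph_Theory"
begin

definition shortcut_set :: "'a pair_pre_digraph \<Rightarrow> ('a \<times> 'a) set \<Rightarrow> bool" where
  "shortcut_set G H \<longleftrightarrow> (\<forall>(u, v)\<in>H. u \<noteq> v \<and> u \<rightarrow>\<^sup>*\<^bsub>with_proj G\<^esub> v)"

definition add_arcs :: "'a pair_pre_digraph \<Rightarrow> ('a \<times> 'a) set \<Rightarrow> 'a pair_pre_digraph" where
  "add_arcs G H = \<lparr> pverts = pverts G, parcs = parcs G \<union> H \<rparr>"

text \<open>With every arc of weight 1 the cost of a walk is its number of arcs, so the library's
  shortest-path distance becomes the unweighted one. It is specified only for well-formed
  digraphs; adding a shortcut set preserves well-formedness.\<close>

definition unweighted_dist :: "'a pair_pre_digraph \<Rightarrow> 'a \<Rightarrow> 'a \<Rightarrow> ereal" where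
  "unweighted_dist G u v = wf_digraph.\<mu> (with_proj G) (\<lambda>_. 1) u v"

text \<open>For a finite digraph and a nonempty set \<open>S\<close> of its vertices, the supremum is over a
  finite nonempty set, hence a maximum.\<close>

definition sourcewise_diameter :: "'a pair_pre_digraph \<Rightarrow> 'a set \<Rightarrow> ereal" where
  "sourcewise_diameter G S =
    (SUP (s, v) \<in> {(s, v) \<in> S \<times> pverts G. s \<rightarrow>\<^sup>*\<^bsub>with_proj G\<^esub> v}. unweighted_dist G s v)"

end

theory Submission
  imports Defs "HOL-Library.Countable"
begin

text \<open>
  The graph has \<open>N + 2\<close> layers, where \<open>N\<close> is a power of two. In layer \<open>k\<close> a path may advance in
  either of two coordinates, at a cost that depends on \<open>k\<close>. A path with speeds \<open>a\<close> and \<open>c\<close> advances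
  exactly when the cost is below a threshold, so it is the unique minimiser of a linear functional
  and hence the unique path between its ends. There are \<open>T N\<^sup>3\<close> sources, for a large constant \<open>T\<close>, and
  \<open>N\<^sup>d\<close> paths start at each of them (two speeds and \<open>N\<^bsup>d-2\<^esup>\<close> disjoint copies), but only
  \<open>O(N\<^bsup>d+3\<^esup>)\<close> vertices and arcs, with a constant independent of \<open>T\<close>. A shortcut over \<open>l > T + 1\<close>
  layers serves only \<open>O(N / l)\<close> paths, because the costs along any \<open>l\<close> consecutive layers are well
  spread. Hence each shortcut saves \<open>O(N)\<close> layers over all paths together, whereas a
  diameter below \<open>N / (2 T + 2)\<close> requires saving half of the layers of each path, so about
  \<open>T N\<^bsup>d+3\<^esup>\<close> shortcuts are needed.
\<close>

section \<open>Systems of unique paths\<close>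

lemma shortcut_set_subset:
  assumes "pair_wf_digraph G" "shortcut_set G H"
  shows "H \<subseteq> pverts G \<times> pverts G"
proof -
  interpret pair_wf_digraph G by fact
  show ?thesis
    using assms(2) unfolding shortcut_set_def
    by (auto dest: reachable_in_verts)
qed

lemma add_arcs_wf:
  assumes "pair_wf_digraph G" "shortcut_set G H"
  shows "pair_wf_digraph (add_arcs G H)"
proof -
  interpret pair_wf_digraph G by fact
  show ?thesis
    using shortcut_set_subset[OF assms]
    by unfold_locales (auto simp: add_arcs_def dest: in_arcsD1 in_arcsD2)
qed

text \<open>The potential \<open>\<Psi> \<tau>\<close> certifies that \<open>P \<tau>\<close> is the only path between any two of its
  vertices: it never decreases along an arc, and the only arc leaving the path on which it stays 0
  is the next arc of the path.\<close>

locale path_system = pair_digraph G for G :: "'v pair_pre_digraph" +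
  fixes Q :: "'t set" and P :: "'t \<Rightarrow> nat \<Rightarrow> 'v" and L :: nat
    and lay :: "'v \<Rightarrow> nat" and \<Psi> :: "'t \<Rightarrow> 'v \<Rightarrow> int"
  assumes finite_Q: "finite Q"
    and path_lay: "\<tau> \<in> Q \<Longrightarrow> i \<le> L \<Longrightarrow> lay (P \<tau> i) = i"
    and path_arc: "\<tau> \<in> Q \<Longrightarrow> i < L \<Longrightarrow> (P \<tau> i, P \<tau> (Suc i)) \<in> parcs G"
    and pot_mono: "\<tau> \<in> Q \<Longrightarrow> (u, v) \<in> parcs G \<Longrightarrow> \<Psi> \<tau> u \<le> \<Psi> \<tau> v"
    and pot_path: "\<tau> \<in> Q \<Longrightarrow> i \<le> L \<Longrightarrow> \<Psi> \<tau> (P \<tau> i) = 0"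
    and pot_tight: "\<tau> \<in> Q \<Longrightarrow> i \<le> L \<Longrightarrow> (P \<tau> i, v) \<in> parcs G \<Longrightarrow> \<Psi> \<tau> v \<le> 0
      \<Longrightarrow> i < L \<and> v = P \<tau> (Suc i)"
    and L_pos: "0 < L"
begin

abbreviation on_path :: "'t \<Rightarrow> 'v \<Rightarrow> bool" where
  "on_path \<tau> u \<equiv> u \<in> P \<tau> ` {..L}"

abbreviation gap :: "'v \<times> 'v \<Rightarrow> nat" where
  "gap e \<equiv> lay (snd e) - lay (fst e)"

lemma path_in_verts: "\<tau> \<in> Q \<Longrightarrow> i \<le> L \<Longrightarrow> P \<tau> i \<in> pverts G"
  using path_arc[of \<tau> i] path_arc[of \<tau> "i - 1"] L_pos
  by (cases "i < L") (auto dest: in_arcsD1 in_arcsD2)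

lemma pot_mono_reachable:
  assumes "u \<rightarrow>\<^sup>*\<^bsub>with_proj G\<^esub> v" "\<tau> \<in> Q"
  shows "\<Psi> \<tau> u \<le> \<Psi> \<tau> v"
  using assms(1)
proof (induction rule: reachable_induct)
  case (step x y)
  then show ?case using pot_mono[OF \<open>\<tau> \<in> Q\<close>, of x y] by auto
qed simp

text \<open>By monotonicity every vertex on the way to \<open>v\<close> also has potential at most
  0, so \<open>pot_tight\<close> forces each arc to be the next arc of the path.\<close>

lemma reachable_tight:
  assumes "P \<tau> i \<rightarrow>\<^sup>*\<^bsub>with_proj G\<^esub> v" "\<tau> \<in> Q" "i \<le> L" "\<Psi> \<tau> v \<le> 0"
  shows "\<exists>k. i \<le> k \<and> k \<le> L \<and> v = P \<tau> k"
  using assms(1,4)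
proof (induction rule: reachable_induct)
  case base
  then show ?case using \<open>i \<le> L\<close> by auto
next
  case (step x y)
  then have arc: "(x, y) \<in> parcs G" by auto
  with pot_mono[OF \<open>\<tau> \<in> Q\<close> arc] step obtain k where k: "i \<le> k" "k \<le> L" "x = P \<tau> k"
    by force
  with pot_tight[of \<tau> k y] arc step \<open>\<tau> \<in> Q\<close> show ?case
    by (intro exI[of _ "Suc k"]) auto
qed

lemma path_reachable:
  assumes "\<tau> \<in> Q" "i \<le> k" "k \<le> L"
  shows "P \<tau> i \<rightarrow>\<^sup>*\<^bsub>with_proj G\<^esub> P \<tau> k"
  using assms(2,3)
proof (induction k rule: dec_induct)
  case base
  then show ?case using path_in_verts[OF assms(1)] by auto
next
  case (step k)
  then show ?case using path_arc[OF assms(1), of k]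
    by (meson Suc_le_lessD dominatesI less_imp_le_nat reachable_adj_trans)
qed

text \<open>Between two common vertices \<open>P \<tau>'\<close> starts on \<open>P \<tau>\<close>
  and ends at potential 0, so \<open>reachable_tight\<close> keeps it on \<open>P \<tau>\<close>;
  the layers then match the indices.\<close>

lemma paths_agree:
  assumes "\<tau> \<in> Q" "\<tau>' \<in> Q" "m \<le> i" "i \<le> n" "n \<le> L"
    and eq: "P \<tau> m = P \<tau>' m" "P \<tau> n = P \<tau>' n"
  shows "P \<tau> i = P \<tau>' i"
proof -
  have "\<Psi> \<tau> (P \<tau>' i) \<le> 0"
    using pot_mono_reachable[OF path_reachable[of \<tau>' i n] assms(1)] pot_path[of \<tau> n] assms
    by simp
  moreover have "P \<tau> m \<rightarrow>\<^sup>*\<^bsub>with_proj G\<^esub> P \<tau>' i"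
    using path_reachable[of \<tau>' m i] assms by simp
  moreover have "m \<le> L" using assms by simp
  ultimately obtain k where k: "k \<le> L" "P \<tau>' i = P \<tau> k"
    using reachable_tight \<open>\<tau> \<in> Q\<close> by blast
  have "i = lay (P \<tau>' i)" using path_lay[of \<tau>' i] assms by simp
  also have "\<dots> = k" unfolding k(2) by (rule path_lay[OF \<open>\<tau> \<in> Q\<close> k(1)])
  finally show ?thesis using k(2) by simp
qed

text \<open>Shortcuts over at most \<open>K\<close> layers are left out: they are charged like
  ordinary arcs.\<close>

definition used :: "('v \<times> 'v) set \<Rightarrow> nat \<Rightarrow> 't \<Rightarrow> ('v \<times> 'v) set" where
  "used H K \<tau> = {e \<in> H. lay (fst e) + K < lay (snd e) \<and> on_path \<tau> (fst e) \<and> on_path \<tau> (snd e)}"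

text \<open>Every arc of such a walk ends on \<open>P \<tau>\<close> again, and advances either by
  at most \<open>K\<close> layers or along a shortcut in \<open>used H K \<tau>\<close>. Restricting
  the sum to tails in layer \<open>i\<close> or later keeps the induction from counting a shortcut
  twice.\<close>

lemma walk_covers:
  assumes H: "shortcut_set G H" and \<tau>: "\<tau> \<in> Q" and K: "1 \<le> K"
    and walk: "pre_digraph.awalk (with_proj (add_arcs G H)) (P \<tau> i) p (P \<tau> L)" and i: "i \<le> L"
  shows "L - i \<le> K * length p + (\<Sum>e | e \<in> used H K \<tau> \<and> i \<le> lay (fst e). gap e)"
proof -
  interpret A: pair_wf_digraph "add_arcs G H"
    using add_arcs_wf[OF pair_wf_digraph H] .
  have finH: "finite H"
    using shortcut_set_subset[OF pair_wf_digraph H] pair_finite_verts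
    by (meson finite_SigmaI finite_subset)
  then have finU: "finite (used H K \<tau>)" by (simp add: used_def)
  have arcG: "x \<rightarrow>\<^sup>*\<^bsub>with_proj G\<^esub> y" if "(x, y) \<in> parcs (add_arcs G H)" for x y
    using that H by (auto simp: add_arcs_def shortcut_set_def)
  have walkG: "x \<rightarrow>\<^sup>*\<^bsub>with_proj G\<^esub> y" if "A.awalk x q y" for x q y
    using that
  proof (induction q arbitrary: x)
    case Nil
    then have "x = y" "x \<in> pverts (add_arcs G H)" by (auto simp: A.awalk_Nil_iff)
    then show ?case by (simp add: add_arcs_def)
  next
    case (Cons e q)
    then show ?case using arcG[of x "snd e"] by (auto simp: A.awalk_Cons_iff intro: reachable_trans)
  qed
  show ?thesis using walk i
  proof (induction p arbitrary: i)
    case Nil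
    then have "P \<tau> i = P \<tau> L" by (simp add: A.awalk_Nil_iff)
    then have "lay (P \<tau> i) = lay (P \<tau> L)" by (rule arg_cong)
    then have "i = L" unfolding path_lay[OF \<tau> Nil.prems(2)] path_lay[OF \<tau> order_refl] .
    then show ?case by simp
  next
    case (Cons e p)
    define w where "w = snd e"
    from Cons.prems(1) have e: "e = (P \<tau> i, w)" "e \<in> parcs (add_arcs G H)" and p: "A.awalk w p (P \<tau> L)"
      by (auto simp: A.awalk_Cons_iff w_def)
    have \<Psi>w: "\<Psi> \<tau> w \<le> 0"
      using pot_mono_reachable[OF walkG[OF p] \<tau>] pot_path[OF \<tau>, of L] by simp
    moreover have "P \<tau> i \<rightarrow>\<^sup>*\<^bsub>with_proj G\<^esub> w" using arcG e by simp
    ultimately obtain k where k: "i \<le> k" "k \<le> L" "w = P \<tau> k"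
      using reachable_tight \<tau> Cons.prems(2) by blast
    let ?S = "\<lambda>j. {e \<in> used H K \<tau>. j \<le> lay (fst e)}"
    have IH: "L - k \<le> K * length p + sum gap (?S k)"
      using Cons.IH p k by simp
    show ?case
    proof (cases "k - i \<le> K")
      case True
      have "sum gap (?S k) \<le> sum gap (?S i)"
        using finU k by (intro sum_mono2) auto
      with IH True k show ?thesis by simp
    next
      case False
      have "e \<notin> parcs G"
      proof
        assume "e \<in> parcs G"
        then have "i < L" "w = P \<tau> (Suc i)"
          using pot_tight[OF \<tau> Cons.prems(2)] e(1) \<Psi>w by auto
        then have "lay w = Suc i" using path_lay[OF \<tau>, of "Suc i"] by simp
        moreover have "lay w = k" using path_lay[OF \<tau> k(2)] k(3) by simp
        ultimately have "k = Suc i" by simp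
        with False K show False by simp
      qed
      then have "e \<in> H" using e by (auto simp: add_arcs_def)
      then have eU: "e \<in> used H K \<tau>"
        using e k False Cons.prems(2) path_lay[OF \<tau>] by (simp add: used_def)
      have layi: "lay (fst e) = i" "lay (snd e) = k"
        using e k Cons.prems(2) path_lay[OF \<tau>] by simp_all
      have "sum gap (insert e (?S k)) \<le> sum gap (?S i)"
        using finU k eU layi by (intro sum_mono2) auto
      moreover have "sum gap (insert e (?S k)) = gap e + sum gap (?S k)"
        using finU False layi by (subst sum.insert) auto
      ultimately show ?thesis using IH layi k by simp
    qed
  qed
qed

text \<open>Double counting of the pairs of a long shortcut and a path that contains both of its ends,
  weighted by the number of layers that the shortcut skips.\<close>

lemma shortcuts_needed:
  assumes H: "shortcut_set G H" and K: "1 \<le> K"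
    and src: "\<And>\<tau>. \<tau> \<in> Q \<Longrightarrow> P \<tau> 0 \<in> S"
    and mult: "\<And>u v. lay u + K < lay v \<Longrightarrow>
      card {\<tau> \<in> Q. on_path \<tau> u \<and> on_path \<tau> v} * (lay v - lay u) \<le> W"
    and diam: "sourcewise_diameter (add_arcs G H) S < ereal q"
    and q: "2 * real K * q \<le> real L"
  shows "card Q * L \<le> 2 * card H * W"
proof -
  interpret A: pair_wf_digraph "add_arcs G H"
    using add_arcs_wf[OF pair_wf_digraph H] .
  have finH: "finite H"
    using shortcut_set_subset[OF pair_wf_digraph H] pair_finite_verts
    by (meson finite_SigmaI finite_subset)
  have each: "L \<le> 2 * sum gap (used H K \<tau>)" if \<tau>: "\<tau> \<in> Q" for \<tau>
  proof -
    have "P \<tau> 0 \<rightarrow>\<^sup>*\<^bsub>with_proj (add_arcs G H)\<^esub> P \<tau> L"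
      using path_reachable[OF \<tau> le0 order_refl]
    proof (rule pre_digraph.reachable_mono)
      show "subgraph (with_proj G) (with_proj (add_arcs G H))"
        unfolding subgraph_def compatible_def
        by (intro conjI wf_digraph A.wf_digraph) (auto simp: add_arcs_def)
    qed
    moreover have "P \<tau> L \<in> pverts (add_arcs G H)"
      using path_in_verts[OF \<tau>] by (simp add: add_arcs_def)
    ultimately have "unweighted_dist (add_arcs G H) (P \<tau> 0) (P \<tau> L)
        \<le> sourcewise_diameter (add_arcs G H) S"
      unfolding sourcewise_diameter_def using src[OF \<tau>]
      by (intro SUP_upper2[of "(P \<tau> 0, P \<tau> L)"]) auto
    with diam have "A.\<mu> (\<lambda>_. 1) (P \<tau> 0) (P \<tau> L) < ereal q"
      by (simp add: unweighted_dist_def)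
    then obtain p where p: "A.awalk (P \<tau> 0) p (P \<tau> L)" "A.awalk_cost (\<lambda>_. 1) p < q"
      unfolding A.\<mu>_def INF_less_iff by auto
    have "A.awalk_cost (\<lambda>_. 1) p = real (length p)"
      by (induction p) auto
    with p have len: "real (length p) < q" by simp
    \<comment> \<open>Arcs advancing at most \<open>K\<close> layers cover at most half of the
      \<open>L\<close> layers; long shortcuts must cover the rest.\<close>
    have "2 * K * length p \<le> L"
      using mult_left_mono[OF less_imp_le[OF len], of "2 * real K"] q
      by (metis (mono_tags, opaque_lifting) of_nat_0_le_iff of_nat_le_iff of_nat_mult of_nat_numeral
          order_trans zero_le_mult_iff zero_le_numeral)
    moreover have "L \<le> K * length p + sum gap (used H K \<tau>)"
      using walk_covers[OF H \<tau> K p(1)] by simp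
    ultimately show ?thesis by simp
  qed
  have "card Q * L = (\<Sum>\<tau>\<in>Q. L)" by simp
  also have "\<dots> \<le> (\<Sum>\<tau>\<in>Q. 2 * sum gap (used H K \<tau>))"
    by (intro sum_mono each)
  also have "\<dots> = 2 * (\<Sum>\<tau>\<in>Q. \<Sum>e\<in>{e \<in> H. e \<in> used H K \<tau>}. gap e)"
    by (simp add: sum_distrib_left used_def)
  also have "(\<Sum>\<tau>\<in>Q. \<Sum>e\<in>{e \<in> H. e \<in> used H K \<tau>}. gap e)
      = (\<Sum>e\<in>H. \<Sum>\<tau>\<in>{\<tau> \<in> Q. e \<in> used H K \<tau>}. gap e)"
    using finite_Q finH by (rule sum.swap_restrict)
  also have "\<dots> \<le> (\<Sum>e\<in>H. W)"
  proof (rule sum_mono)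
    fix e assume "e \<in> H"
    show "(\<Sum>\<tau>\<in>{\<tau> \<in> Q. e \<in> used H K \<tau>}. gap e) \<le> W"
    proof (cases "lay (fst e) + K < lay (snd e)")
      case True
      then have "{\<tau> \<in> Q. e \<in> used H K \<tau>} = {\<tau> \<in> Q. on_path \<tau> (fst e) \<and> on_path \<tau> (snd e)}"
        using \<open>e \<in> H\<close> by (auto simp: used_def)
      with mult[OF True] show ?thesis by simp
    qed (simp add: used_def)
  qed
  finally show ?thesis by simp
qed

end

section \<open>Bit reversal\<close>

text \<open>Only the lowest \<open>b\<close> bits of \<open>k\<close> matter. For
  \<open>k < 2 ^ b\<close> the values divided by \<open>2 ^ b\<close> are the first terms of the van
  der Corput sequence.\<close>

fun bit_rev :: "nat \<Rightarrow> nat \<Rightarrow> nat" where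
  "bit_rev 0 k = 0"
| "bit_rev (Suc b) k = (k mod 2) * 2 ^ b + bit_rev b (k div 2)"

lemma bit_rev_less: "bit_rev b k < 2 ^ b"
proof (induction b arbitrary: k)
  case (Suc b)
  have "(k mod 2) * 2 ^ b \<le> 1 * 2 ^ b" by (intro mult_right_mono) auto
  then have "(k mod 2) * 2 ^ b + bit_rev b (k div 2) < 1 * 2 ^ b + 2 ^ b"
    using Suc[of "k div 2"] by (rule add_le_less_mono)
  then show ?case by simp
qed simp

text \<open>On an aligned block of length \<open>2 ^ j\<close> the lowest \<open>j\<close> bits take
  all patterns, and reversal makes them the leading \<open>j\<close> of \<open>b\<close>
  bits.\<close>

lemma bit_rev_block:
  "j \<le> b \<Longrightarrow> q < 2 ^ j \<Longrightarrow> \<exists>k. k div 2 ^ j = m \<and> bit_rev b k div 2 ^ (b - j) = q"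
proof (induction j arbitrary: b q)
  case 0
  then show ?case using bit_rev_less[of b m] by (intro exI[of _ m]) auto
next
  case (Suc j)
  then obtain b' where b: "b = Suc b'" "j \<le> b'" by (cases b) auto
  define r where "r = q div 2 ^ j"
  have r: "r < 2" using Suc.prems by (simp add: r_def less_mult_imp_div_less mult.commute)
  have q: "q = r * 2 ^ j + q mod 2 ^ j" unfolding r_def by (rule div_mult_mod_eq[symmetric])
  from Suc.IH[OF b(2), of "q mod 2 ^ j"] obtain k
    where k: "k div 2 ^ j = m" "bit_rev b' k div 2 ^ (b' - j) = q mod 2 ^ j" by auto
  \<comment> \<open>The lowest bit of the witness \<open>2 * k + r\<close> becomes the leading bit
    of the reversed number.\<close>
  have kd: "(2 * k + r) div 2 ^ Suc j = m"
    using k r by (simp add: div_mult2_eq)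
  have "r * 2 ^ b' = r * 2 ^ j * 2 ^ (b' - j)"
    using b by (simp add: power_add[symmetric])
  then have "r * 2 ^ b' div 2 ^ (b' - j) = r * 2 ^ j"
    by (metis nonzero_mult_div_cancel_right power_not_zero zero_neq_numeral)
  moreover have "(2::nat) ^ (b' - j) dvd r * 2 ^ b'"
    by (simp add: le_imp_power_dvd)
  ultimately have "(r * 2 ^ b' + bit_rev b' k) div 2 ^ (b' - j) = q"
    using k q by (subst div_plus_div_distrib_dvd_left) auto
  then have "bit_rev b (2 * k + r) div 2 ^ (b - Suc j) = q"
    using r b by simp
  with kd show ?case by blast
qed

text \<open>The window contains an aligned block of \<open>B\<close> indices, where
  \<open>2 * B \<le> w < 4 * B\<close>. The interval of values is longer than \<open>2 * D\<close>
  with \<open>B * D = 2 ^ b\<close>, so it contains an aligned cell of length \<open>D\<close>,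
  which the block hits by \<open>bit_rev_block\<close>. The constant 8 is the product of these 2 and
  4.\<close>

lemma bit_rev_separates:
  assumes w: "2 \<le> w" "i + w \<le> 2 ^ b" and gap: "8 * 2 ^ b \<le> (a' - a) * w" and a': "a' \<le> 2 ^ b"
  shows "\<exists>k\<in>{i..<i + w}. a \<le> bit_rev b k \<and> bit_rev b k < a'"
proof -
  have "\<exists>j. 2 * 2 ^ j \<le> w \<and> w < 4 * 2 ^ j"
    using w(1)
  proof (induction w rule: less_induct)
    case (less w)
    show ?case
    proof (cases "w < 4")
      case True
      with less.prems show ?thesis by (intro exI[of _ 0]) auto
    next
      case False
      then have "w div 2 < w" "2 \<le> w div 2" by linarith+
      then obtain j where "2 * 2 ^ j \<le> w div 2" "w div 2 < 4 * 2 ^ j"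
        using less.IH[of "w div 2"] by blast
      then show ?thesis by (intro exI[of _ "Suc j"]) auto
    qed
  qed
  then obtain j where j: "2 * 2 ^ j \<le> w" "w < 4 * 2 ^ j" by blast
  have "(2::nat) ^ j < 2 ^ b" using j w by linarith
  then have jb: "j \<le> b" by simp
  define B :: nat where "B = 2 ^ j"
  define D :: nat where "D = 2 ^ (b - j)"
  have BD: "2 ^ b = B * D" and pos: "B > 0" "D > 0"
    using jb by (simp_all add: B_def D_def flip: power_add)
  have gap2: "2 * D < a' - a"
  proof (rule ccontr)
    assume "\<not> 2 * D < a' - a"
    then have "(a' - a) * w \<le> 2 * D * w" by (intro mult_right_mono) auto
    also have "\<dots> < 2 * D * (4 * B)" using j pos by (simp add: B_def)
    finally show False using gap BD by (simp add: mult.commute)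
  qed
  \<comment> \<open>Both quotients are rounded up: \<open>q\<close> numbers the cell and
    \<open>m\<close> the block.\<close>
  define q where "q = (a + D - 1) div D"
  define m where "m = (i + B - 1) div B"
  have qD: "a \<le> q * D" "q * D < a + D"
    using pos div_mult_mod_eq[of "a + D - 1" D] mod_less_divisor[of D "a + D - 1"]
    unfolding q_def by linarith+
  have mB: "i \<le> m * B" "m * B < i + B"
    using pos div_mult_mod_eq[of "i + B - 1" B] mod_less_divisor[of B "i + B - 1"]
    unfolding m_def by linarith+
  have "q * D < B * D" using qD gap2 a' BD by linarith
  then have "q < 2 ^ j" using pos by (simp add: B_def)
  from bit_rev_block[OF jb this, of m] obtain k
    where k: "k div B = m" "bit_rev b k div D = q" unfolding B_def D_def by blast
  have "m * B + k mod B = k" "q * D + bit_rev b k mod D = bit_rev b k"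
    using k by (metis div_mult_mod_eq)+
  then have "m * B \<le> k" "k < m * B + B" "q * D \<le> bit_rev b k" "bit_rev b k < q * D + D"
    using pos mod_less_divisor[of B k] mod_less_divisor[of D "bit_rev b k"] by linarith+
  then show ?thesis
    using mB qD gap2 j by (intro bexI[of _ k]) (auto simp: B_def)
qed

text \<open>The extreme elements of \<open>A\<close> are not separated either, so they differ by
  less than \<open>8 * 2 ^ b / w\<close>. Counting both ends adds \<open>w \<le> 2 ^ b\<close>,
  which turns 8 into 9.\<close>

lemma card_unseparated_le:
  assumes A: "A \<subseteq> {..2 ^ b}" and w: "2 \<le> w" "i + w \<le> 2 ^ b"
    and unsep: "\<And>a a' k. a \<in> A \<Longrightarrow> a' \<in> A \<Longrightarrow> k \<in> {i..<i + w} \<Longrightarrow> bit_rev b k < a \<longleftrightarrow> bit_rev b k < a'"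
  shows "card A * w \<le> 9 * 2 ^ b"
proof (cases "A = {}")
  case False
  have fin: "finite A" using A by (rule finite_subset) simp
  have mem: "Min A \<in> A" "Max A \<in> A" using fin False by auto
  have "\<not> 8 * 2 ^ b \<le> (Max A - Min A) * w"
  proof
    assume "8 * 2 ^ b \<le> (Max A - Min A) * w"
    moreover have "Max A \<le> 2 ^ b" using A mem by auto
    ultimately obtain k where "k \<in> {i..<i + w}" "Min A \<le> bit_rev b k" "bit_rev b k < Max A"
      using bit_rev_separates[OF w] by blast
    with unsep[OF mem(1,2)] show False by fastforce
  qed
  moreover have "A \<subseteq> {Min A..Max A}" using fin by auto
  then have "card A \<le> Suc (Max A) - Min A" using card_mono[of "{Min A..Max A}" A] by simp
  then have "card A \<le> Max A - Min A + 1" by simp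
  then have "card A * w \<le> (Max A - Min A + 1) * w" by (rule mult_right_mono) simp
  ultimately show ?thesis using w by (simp add: algebra_simps)
qed simp

section \<open>The layered graph\<close>

text \<open>An advance changes the functional by \<open>w - 2 a\<close>, so it pays exactly when
  this is negative.\<close>

lemma bit_cost_min:
  "of_bool (w < 2 * a) * (int w - 2 * int a) \<le> of_bool p * (int w - 2 * int a)"
  by (cases p) auto

lemma bit_cost_min_unique:
  assumes "odd w" "of_bool p * (int w - 2 * int a) \<le> of_bool (w < 2 * a) * (int w - 2 * int a)"
  shows "p \<longleftrightarrow> w < 2 * a"
proof -
  have "w \<noteq> 2 * a" using assms(1) by auto
  then show ?thesis using assms(2) by (cases p; cases "w < 2 * a") auto
qed

section \<open>Displacement and cost accumulated at a fixed speed\<close>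

definition disp :: "(nat \<Rightarrow> nat) \<Rightarrow> nat \<Rightarrow> nat \<Rightarrow> nat" where
  "disp w a i = (\<Sum>k<i. of_bool (w k < 2 * a))"

definition cost :: "(nat \<Rightarrow> nat) \<Rightarrow> nat \<Rightarrow> nat \<Rightarrow> nat" where
  "cost w a i = (\<Sum>k<i. of_bool (w k < 2 * a) * w k)"

lemma disp_Suc [simp]: "disp w a (Suc i) = disp w a i + of_bool (w i < 2 * a)"
  and disp_0 [simp]: "disp w a 0 = 0"
  by (auto simp: disp_def)

lemma cost_Suc [simp]: "cost w a (Suc i) = cost w a i + of_bool (w i < 2 * a) * w i"
  and cost_0 [simp]: "cost w a 0 = 0"
  by (auto simp: cost_def)

lemma disp_le: "disp w a i \<le> i"
  by (induction i) auto

lemma cost_le: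
  assumes "\<And>k. k < i \<Longrightarrow> w k < 2 * n"
  shows "cost w a i \<le> i * (2 * n - 1)"
  using assms
proof (induction i)
  case (Suc i)
  then have "cost w a i \<le> i * (2 * n - 1)" "w i \<le> 2 * n - 1" by fastforce+
  then show ?case by (auto simp: of_bool_def)
qed simp

text \<open>The numbers are congruent modulo \<open>M\<close>, so if distinct they differ by at
  least \<open>M\<close>, and some multiple of \<open>M\<close> separates them.\<close>

lemma same_residue_same_class:
  fixes M T c c' e e' :: nat
  assumes M: "0 < M" and c: "c < M * T" "c' < M * T"
    and res: "M * e + c = M * e' + c'" and cls: "\<And>r. r < T \<Longrightarrow> M * r < c \<longleftrightarrow> M * r < c'"
  shows "c = c'"
proof -
  have False if "x < y" "M * e + x = M * e' + y" "y < M * T"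
    "\<And>r. r < T \<Longrightarrow> M * r < x \<longleftrightarrow> M * r < y" for x y e e'
  proof -
    have "M * e' < M * e" using that by linarith
    then have "e' + 1 \<le> e" by simp
    then have "M * (e' + 1) \<le> M * e" by (rule mult_left_mono) simp
    then have "x + M \<le> y" using that by simp
    \<comment> \<open>\<open>M * r\<close> is the least multiple of \<open>M\<close> that is at
      least \<open>x\<close>.\<close>
    define r where "r = (x + M - 1) div M"
    have "M * r + (x + M - 1) mod M = x + M - 1" unfolding r_def by simp
    then have r: "x \<le> M * r" "M * r < x + M"
      using M mod_less_divisor[OF M, of "x + M - 1"] by linarith+
    then have "M * r < M * T" using \<open>x + M \<le> y\<close> that by linarith
    then have "r < T" by simp
    with that(4)[of r] r \<open>x + M \<le> y\<close> show False by simp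
  qed
  from this[of c c' e e'] this[of c' c e' e] assms show ?thesis
    by (metis linorder_neqE_nat)
qed

lemma residue_in_window:
  fixes T r w i :: nat
  assumes "r < T" "T \<le> w"
  shows "\<exists>k\<in>{i..<i + w}. k mod T = r"
proof -
  let ?k = "if i mod T \<le> r then i + (r - i mod T) else i + (T + r - i mod T)"
  have iT: "i mod T < T" using assms by simp
  have "?k mod T = r"
  proof (cases "i mod T \<le> r")
    case True
    have "(i + (r - i mod T)) mod T = (i mod T + (r - i mod T)) mod T" by (simp add: mod_add_left_eq)
    then show ?thesis using True assms by simp
  next
    case False
    have "(i + (T + r - i mod T)) mod T = (i mod T + (T + r - i mod T)) mod T"
      by (simp add: mod_add_left_eq)
    then show ?thesis using False assms iT by simp
  qed
  then show ?thesis using assms iT by (intro bexI[of _ ?k]) auto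
qed

text \<open>A vertex \<open>(l, x, z, y, j)\<close> consists of its layer, two positions, an accumulated cost and the
  number of its copy. An index \<open>(x, e, y, a, c, j)\<close> consists of the data \<open>x, e, y\<close> of a source, two
  speeds \<open>a, c\<close> and a copy.\<close>

type_synonym vert = "nat \<times> nat \<times> nat \<times> nat \<times> nat"
type_synonym index = "nat \<times> nat \<times> nat \<times> nat \<times> nat \<times> nat"

text \<open>\<open>J\<close> is the number of copies, and \<open>M\<close> the spacing of the
  \<open>T\<close> thresholds against which the second speed is tested.\<close>

locale layered_graph =
  fixes b M T J :: nat
  assumes MT: "2 ^ b = M * T" and J_pos: "0 < J"
begin

abbreviation N :: nat where "N \<equiv> 2 ^ b"

lemma M_pos: "0 < M" and T_pos: "0 < T"
  using MT by (auto intro: Nat.gr0I)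

text \<open>\<open>w1 k < 2 * a\<close> says \<open>bit_rev b k < a\<close>, and
  \<open>w2 k < 2 * c\<close> says \<open>M * (k mod T) < c\<close>. Thus any \<open>T\<close>
  consecutive layers test \<open>c\<close> against all multiples of \<open>M\<close> below
  \<open>N\<close>.\<close>

definition w1 :: "nat \<Rightarrow> nat" where "w1 k = 2 * bit_rev b k + 1"

definition w2 :: "nat \<Rightarrow> nat" where "w2 k = 2 * (M * (k mod T)) + 1"

lemma w_odd: "odd (w1 k)" "odd (w2 k)"
  by (auto simp: w1_def w2_def)

lemma w1_less: "w1 k < 2 * N"
  using bit_rev_less[of b k] by (simp add: w1_def)

lemma w2_less: "w2 k < 2 * N"
proof -
  have "M * (k mod T) < N" using T_pos M_pos by (simp add: MT)
  then show ?thesis unfolding w2_def by linarith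
qed

text \<open>The second position starts at a multiple of \<open>M\<close>, so that later positions,
  less the displacement, reveal \<open>c\<close> modulo \<open>M\<close>.\<close>

definition sources :: "vert set" where
  "sources = (\<lambda>(x, e, y). (0, x, M * e, y, 0)) ` ({..<N} \<times> {..<T} \<times> {..<N ^ 2})"

text \<open>The ranges have room for every path: each displacement is at most \<open>N\<close>, and
  \<open>y\<close>, \<open>c ^ 2\<close> and the two costs add up to less than
  \<open>N ^ 2 + N ^ 2 + 2 * (2 * N ^ 2)\<close>. None of them involves \<open>T\<close>.\<close>

definition inner :: "vert set" where
  "inner = {1..N + 1} \<times> {..<2 * N} \<times> {..<3 * N} \<times> {..<6 * N ^ 2} \<times> {..<J}"

text \<open>The quadratic cost of the first move makes \<open>c\<close> the unique minimiser of the cost minus \<open>2 c\<close>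
  times the displacement; the weights \<open>w1, w2\<close> are odd, so that they never tie with \<open>2 a\<close> and
  \<open>2 c\<close>.\<close>

definition fan :: "vert \<times> nat \<times> nat \<Rightarrow> vert \<times> vert" where
  "fan = (\<lambda>((l, x, z, y, i), c, j). ((l, x, z, y, i), (1, x, z + c, y + c ^ 2, j)))"

text \<open>Layer 0 is left by \<open>fan\<close>, so the move out of layer \<open>l\<close> uses
  the weights with index \<open>l - 1\<close>.\<close>

definition move :: "vert \<times> bool \<times> bool \<Rightarrow> vert \<times> vert" where
  "move = (\<lambda>((l, x, z, y, j), p, q). ((l, x, z, y, j),
     (Suc l, x + of_bool p, z + of_bool q, y + of_bool p * w1 (l - 1) + of_bool q * w2 (l - 1), j)))"

definition V :: "vert set" where "V = sources \<union> inner"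

definition E :: "(vert \<times> vert) set" where
  "E = (fan ` (sources \<times> {..<N} \<times> {..<J}) \<union> move ` (inner \<times> UNIV)) \<inter> V \<times> V"

definition Q :: "index set" where
  "Q = {..<N} \<times> {..<T} \<times> {..<N ^ 2} \<times> {..<N} \<times> {..<N} \<times> {..<J}"

fun path :: "index \<Rightarrow> nat \<Rightarrow> vert" where
  "path (x, e, y, a, c, j) 0 = (0, x, M * e, y, 0)"
| "path (x, e, y, a, c, j) (Suc l) = (Suc l, x + disp w1 a l, M * e + c + disp w2 c l,
     y + c ^ 2 + cost w1 a l + cost w2 c l, j)"

fun lin :: "index \<Rightarrow> vert \<Rightarrow> int" where
  "lin (x, e, y, a, c, j) (l, x', z', y', j') = int y' - 2 * int a * int x' - 2 * int c * int z'"

text \<open>\<open>lin\<close> does not see the copy, so entering a wrong one is penalised here.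
  Layer 0 is exempt because all copies share the sources.\<close>

definition copy_penalty :: "index \<Rightarrow> vert \<Rightarrow> int" where
  "copy_penalty = (\<lambda>(x, e, y, a, c, j) (l, x', z', y', j'). of_bool (0 < l \<and> j' \<noteq> j))"

definition pot :: "index \<Rightarrow> vert \<Rightarrow> int" where
  "pot \<tau> v = lin \<tau> v - lin \<tau> (path \<tau> (fst v)) + copy_penalty \<tau> v"

lemma fst_path [simp]: "fst (path \<tau> i) = i"
  by (cases \<tau>; cases i) auto

lemma finite_sources [simp]: "finite sources" and finite_inner [simp]: "finite inner"
  and finite_V [simp]: "finite V" and finite_E [simp]: "finite E" and finite_Q [simp]: "finite Q"
  by (auto simp: sources_def inner_def V_def E_def Q_def)

lemma pot_path: "pot \<tau> (path \<tau> i) = 0"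
  by (cases \<tau>; cases i) (auto simp: pot_def copy_penalty_def)

lemma path_0_sources: "\<tau> \<in> Q \<Longrightarrow> path \<tau> 0 \<in> sources"
  unfolding sources_def by (cases \<tau>, rule image_eqI[of _ _ "(fst \<tau>, fst (snd \<tau>), fst (snd (snd \<tau>)))"])
    (auto simp: Q_def)

lemma path_inner:
  assumes "\<tau> \<in> Q" "l \<le> N"
  shows "path \<tau> (Suc l) \<in> inner"
proof -
  obtain x e y a c j where \<tau>: "\<tau> = (x, e, y, a, c, j)" by (cases \<tau>)
  with assms have in_ranges: "x < N" "e < T" "y < N ^ 2" "a < N" "c < N" "j < J" by (auto simp: Q_def)
  have "x + disp w1 a l < 2 * N"
    using disp_le[of w1 a l] in_ranges assms by linarith
  moreover have "M * e \<le> N" using in_ranges MT by simp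
  then have "M * e + c + disp w2 c l < 3 * N"
    using disp_le[of w2 c l] in_ranges assms by linarith
  moreover have "y + c ^ 2 + cost w1 a l + cost w2 c l < 6 * N ^ 2"
  proof -
    have "cost w1 a l \<le> l * (2 * N - 1)" "cost w2 c l \<le> l * (2 * N - 1)"
      by (intro cost_le w1_less w2_less)+
    moreover have "l * (2 * N - 1) \<le> N * (2 * N)"
      using assms by (intro mult_mono) auto
    moreover have "c ^ 2 \<le> N ^ 2" using in_ranges by (intro power_mono) auto
    ultimately show ?thesis using in_ranges by (simp add: power2_eq_square)
  qed
  ultimately show ?thesis
    using assms in_ranges by (simp add: \<tau> inner_def)
qed

lemma path_V: "\<tau> \<in> Q \<Longrightarrow> i \<le> N + 1 \<Longrightarrow> path \<tau> i \<in> V"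
  using path_0_sources path_inner by (cases i) (auto simp: V_def)

lemma path_E:
  assumes "\<tau> \<in> Q" "i < N + 1"
  shows "(path \<tau> i, path \<tau> (Suc i)) \<in> E"
proof -
  obtain x e y a c j where \<tau>: "\<tau> = (x, e, y, a, c, j)" by (cases \<tau>)
  with assms have in_ranges: "c < N" "j < J" by (auto simp: Q_def)
  have "(path \<tau> i, path \<tau> (Suc i)) \<in> fan ` (sources \<times> {..<N} \<times> {..<J}) \<union> move ` (inner \<times> UNIV)"
  proof (cases i)
    case 0
    have "(path \<tau> 0, path \<tau> (Suc 0)) = fan (path \<tau> 0, c, j)"
      by (simp add: \<tau> fan_def)
    with 0 path_0_sources[OF assms(1)] in_ranges show ?thesis by auto
  next
    case (Suc l)
    have "(path \<tau> i, path \<tau> (Suc i)) = move (path \<tau> i, w1 l < 2 * a, w2 l < 2 * c)"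
      by (simp add: \<tau> Suc move_def)
    moreover have "path \<tau> i \<in> inner" using path_inner[OF assms(1), of l] assms Suc by simp
    ultimately show ?thesis by auto
  qed
  with path_V[OF assms(1)] assms show ?thesis by (auto simp: E_def)
qed

lemma E_cases:
  assumes "(u, v) \<in> E"
  obtains (fan) x z y c j where "u = (0, x, z, y, 0)" "v = (1, x, z + c, y + c ^ 2, j)"
  | (move) l x z y j p q where "l < N" "u = (Suc l, x, z, y, j)"
      "v = (Suc (Suc l), x + of_bool p, z + of_bool q, y + of_bool p * w1 l + of_bool q * w2 l, j)"
proof -
  from assms consider "(u, v) \<in> fan ` (sources \<times> {..<N} \<times> {..<J})"
    | "(u, v) \<in> move ` (inner \<times> UNIV)" "v \<in> V" by (auto simp: E_def)
  then show ?thesis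
  proof cases
    case 1
    then show ?thesis by (auto simp: sources_def fan_def intro: fan)
  next
    case 2
    then obtain l x z y j p q where uv: "(l, x, z, y, j) \<in> inner" "u = (l, x, z, y, j)"
      "v = (Suc l, x + of_bool p, z + of_bool q, y + of_bool p * w1 (l - 1) + of_bool q * w2 (l - 1), j)"
      by (auto simp: move_def)
    then obtain l' where "l = Suc l'" by (cases l) (auto simp: inner_def)
    moreover have "l \<le> N" using uv 2(2) by (auto simp: V_def inner_def sources_def)
    ultimately show ?thesis using move[of l'] uv by auto
  qed
qed

lemma E_layer:
  assumes "(u, v) \<in> E"
  shows "fst v = Suc (fst u)" "fst u < N + 1"
  using assms by (auto elim!: E_cases)

text \<open>Along a fan arc completing the square gives the increase \<open>(c - c0) ^ 2\<close>,
  plus 1 for a wrong copy. Along a move the copy is kept, and the increase is the sum of the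
  excesses of two independent one-coordinate choices.\<close>

lemma pot_arc:
  assumes "\<tau> \<in> Q" "(u, v) \<in> E"
  shows "pot \<tau> u \<le> pot \<tau> v"
    and "u = path \<tau> (fst u) \<Longrightarrow> pot \<tau> v \<le> 0 \<Longrightarrow> v = path \<tau> (Suc (fst u))"
proof -
  obtain x0 e0 y0 a0 c0 j0 where \<tau>: "\<tau> = (x0, e0, y0, a0, c0, j0)" by (cases \<tau>)
  have "pot \<tau> u \<le> pot \<tau> v \<and>
    (u = path \<tau> (fst u) \<longrightarrow> pot \<tau> v \<le> 0 \<longrightarrow> v = path \<tau> (Suc (fst u)))"
    using assms(2)
  proof (cases rule: E_cases)
    case (fan x z y c j)
    have diff: "pot \<tau> v - pot \<tau> u = (int c - int c0) ^ 2 + of_bool (j \<noteq> j0)"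
      by (simp add: fan \<tau> pot_def copy_penalty_def algebra_simps power2_eq_square)
    have nonneg: "0 \<le> (int c - int c0) ^ 2" by (rule zero_le_power2)
    then have "0 \<le> (int c - int c0) ^ 2 + of_bool (j \<noteq> j0)" by simp
    with diff have mono: "pot \<tau> u \<le> pot \<tau> v" by linarith
    have "v = path \<tau> (Suc (fst u))" if u: "u = path \<tau> (fst u)" and "pot \<tau> v \<le> 0"
    proof -
      have "pot \<tau> u = 0" using u pot_path by metis
      with diff that have sum: "(int c - int c0) ^ 2 + of_bool (j \<noteq> j0) \<le> 0" by linarith
      have "j = j0"
      proof (rule ccontr)
        assume "j \<noteq> j0"
        then have "(of_bool (j \<noteq> j0) :: int) = 1" by simp
        with sum nonneg show False by linarith
      qed
      with u sum show ?thesis by (simp add: fan \<tau>)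
    qed
    with mono show ?thesis by blast
  next
    case (move l x z y j p q)
    let ?d1 = "of_bool p * (int (w1 l) - 2 * int a0) - of_bool (w1 l < 2 * a0) * (int (w1 l) - 2 * int a0)"
    let ?d2 = "of_bool q * (int (w2 l) - 2 * int c0) - of_bool (w2 l < 2 * c0) * (int (w2 l) - 2 * int c0)"
    have diff: "pot \<tau> v - pot \<tau> u = ?d1 + ?d2"
      by (simp add: move \<tau> pot_def copy_penalty_def algebra_simps)
    have pos: "0 \<le> ?d1" "0 \<le> ?d2"
      using bit_cost_min[of "w1 l" a0 p] bit_cost_min[of "w2 l" c0 q] by simp_all
    have "v = path \<tau> (Suc (fst u))" if u: "u = path \<tau> (fst u)" and "pot \<tau> v \<le> 0"
    proof -
      have "pot \<tau> u = 0" using u pot_path by metis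
      with diff pos that have "?d1 \<le> 0" "?d2 \<le> 0" by linarith+
      then have "p \<longleftrightarrow> w1 l < 2 * a0" "q \<longleftrightarrow> w2 l < 2 * c0"
        using bit_cost_min_unique[OF w_odd(1)[of l], of p a0]
          bit_cost_min_unique[OF w_odd(2)[of l], of q c0] by simp_all
      with u show ?thesis by (simp add: move \<tau>)
    qed
    with diff pos show ?thesis by linarith
  qed
  then show "pot \<tau> u \<le> pot \<tau> v"
    and "u = path \<tau> (fst u) \<Longrightarrow> pot \<tau> v \<le> 0 \<Longrightarrow> v = path \<tau> (Suc (fst u))"
    by auto
qed

text \<open>The tuples are encoded as numbers to obtain the vertex type of the theorem.\<close>

definition G :: "nat pair_pre_digraph" where
  "G = \<lparr> pverts = to_nat ` V, parcs = map_prod to_nat to_nat ` E \<rparr>"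

sublocale path_system G Q "\<lambda>\<tau> i. to_nat (path \<tau> i)" "N + 1" "\<lambda>n. fst (from_nat n :: vert)"
  "\<lambda>\<tau> n. pot \<tau> (from_nat n)"
proof unfold_locales
  fix \<tau> i v
  assume "\<tau> \<in> Q" "i \<le> N + 1" "(to_nat (path \<tau> i), v) \<in> parcs G" "pot \<tau> (from_nat v) \<le> 0"
  then obtain v' where v: "(path \<tau> i, v') \<in> E" "v = to_nat v'" "pot \<tau> v' \<le> 0"
    by (auto simp: G_def)
  then show "i < N + 1 \<and> v = to_nat (path \<tau> (Suc i))"
    using pot_arc(2)[OF \<open>\<tau> \<in> Q\<close> v(1)] E_layer(2)[OF v(1)] by simp
next
  fix \<tau> i
  assume "\<tau> \<in> Q" "i < N + 1"
  from path_E[OF this] have "map_prod to_nat to_nat (path \<tau> i, path \<tau> (Suc i)) \<in> parcs G"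
    unfolding G_def by (auto simp del: map_prod_simp)
  then show "(to_nat (path \<tau> i), to_nat (path \<tau> (Suc i))) \<in> parcs G" by simp
next
  fix e assume "e \<in> parcs G"
  then obtain u v where "(u, v) \<in> E" "e = (to_nat u, to_nat v)" by (auto simp: G_def)
  then show "fst e \<in> pverts G" "snd e \<in> pverts G" "fst e \<noteq> snd e"
    using E_layer(1)[of u v] by (auto simp: G_def E_def)
qed (auto simp: G_def pot_path pot_arc)

text \<open>All paths through both ends coincide in between, so none of the weights met there separates
  their speeds. For the first speed, bit reversal leaves only an interval of \<open>O(N / gap)\<close>
  values. For the second one, all residues modulo \<open>T\<close> occur, which fixes it up to an interval
  of length \<open>M\<close>, while the position at \<open>v\<close> fixes it modulo \<open>M\<close>; the source is then determined as
  well.\<close>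

lemma long_shortcut_on_few_paths:
  assumes "fst (from_nat u :: vert) + (T + 1) < fst (from_nat v :: vert)"
  shows "card {\<tau> \<in> Q. on_path \<tau> u \<and> on_path \<tau> v}
      * (fst (from_nat v :: vert) - fst (from_nat u :: vert)) \<le> 18 * N"
proof -
  let ?R = "{\<tau> \<in> Q. on_path \<tau> u \<and> on_path \<tau> v}"
  define m where "m = fst (from_nat u :: vert)"
  define n where "n = fst (from_nat v :: vert)"
  \<comment> \<open>The moves from the later of layers \<open>m\<close> and 1 up to layer
    \<open>n\<close> use the weights \<open>i\<close>, ..., \<open>i + w - 1\<close>. For
    \<open>m = 0\<close> truncated subtraction gives \<open>i = 0\<close>, since the fan arc uses no
    weight; then \<open>w = n - m - 1\<close>, otherwise \<open>w = n - m\<close>. Hence the factor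
    2 that turns 9 into 18.\<close>
  define i where "i = m - 1"
  define w where "w = n - 1 - i"
  define speed :: "index \<Rightarrow> nat" where "speed = (\<lambda>(x, e, y, a, c, j). a)"
  show ?thesis
  proof (cases "?R = {}")
    case False
    have ends: "to_nat (path \<tau> m) = u" "to_nat (path \<tau> n) = v" "n \<le> N + 1" if "\<tau> \<in> ?R" for \<tau>
      using that by (auto simp: m_def n_def)
    have mn: "m + (T + 1) < n" using assms by (simp add: m_def n_def)
    have n: "n \<le> N + 1" using ends(3) False by blast
    have w: "2 \<le> w" "T \<le> w" "i + w \<le> N" "n - m \<le> 2 * w" "Suc (i + w) = n" "m \<le> Suc i"
      using mn n T_pos by (auto simp: w_def i_def)
    have agree: "path \<tau> k = path \<tau>' k" if "\<tau> \<in> ?R" "\<tau>' \<in> ?R" "m \<le> k" "k \<le> n" for \<tau> \<tau>' k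
      using paths_agree[of \<tau> \<tau>' m k n] that ends[OF that(1)] ends[OF that(2)] by auto
    have same: "(w1 k < 2 * a \<longleftrightarrow> w1 k < 2 * a') \<and> (w2 k < 2 * c \<longleftrightarrow> w2 k < 2 * c')"
      if R: "(x, e, y, a, c, j) \<in> ?R" "(x', e', y', a', c', j') \<in> ?R" and k: "k \<in> {i..<i + w}"
      for x e y a c j x' e' y' a' c' j' k
    proof -
      have "m \<le> Suc k" "Suc (Suc k) \<le> n" using k w by auto
      then have eq: "path (x, e, y, a, c, j) (Suc k) = path (x', e', y', a', c', j') (Suc k)"
        "path (x, e, y, a, c, j) (Suc (Suc k)) = path (x', e', y', a', c', j') (Suc (Suc k))"
        using agree[OF R, of "Suc k"] agree[OF R, of "Suc (Suc k)"] by simp_all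
      have "x + disp w1 a k = x' + disp w1 a' k"
        "M * e + c + disp w2 c k = M * e' + c' + disp w2 c' k"
        using eq(1) by simp_all
      moreover have "x + disp w1 a k + of_bool (w1 k < 2 * a) = x' + disp w1 a' k + of_bool (w1 k < 2 * a')"
        "M * e + c + disp w2 c k + of_bool (w2 k < 2 * c) = M * e' + c' + disp w2 c' k + of_bool (w2 k < 2 * c')"
        using eq(2) by (simp_all only: path.simps disp_Suc prod.inject add.assoc)
      ultimately have "(of_bool (w1 k < 2 * a) :: nat) = of_bool (w1 k < 2 * a')"
        "(of_bool (w2 k < 2 * c) :: nat) = of_bool (w2 k < 2 * c')"
        by linarith+
      then show ?thesis by (simp only: of_bool_eq_iff)
    qed
    have eq_c: "c = c' \<and> j = j' \<and> M * e = M * e'"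
      if R: "(x, e, y, a, c, j) \<in> ?R" "(x', e', y', a', c', j') \<in> ?R"
      for x e y a c j x' e' y' a' c' j'
    proof -
      have cls: "M * r < c \<longleftrightarrow> M * r < c'" if r: "r < T" for r
      proof -
        obtain k where k: "k \<in> {i..<i + w}" "k mod T = r"
          using residue_in_window[OF r w(2)] by blast
        then show ?thesis using same[OF R k(1)] by (auto simp: w2_def)
      qed
      moreover have "w2 k < 2 * x \<longleftrightarrow> M * (k mod T) < x" for k x by (auto simp: w2_def)
      \<comment> \<open>All thresholds of \<open>w2\<close> occur in the window, so the agreement
        extends to layers outside it and the displacements from the start coincide.\<close>
      ultimately have "w2 k < 2 * c \<longleftrightarrow> w2 k < 2 * c'" for k
        using T_pos by simp
      then have "disp w2 c l = disp w2 c' l" for l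
        by (simp add: disp_def)
      moreover have v: "path (x, e, y, a, c, j) (Suc (i + w)) = path (x', e', y', a', c', j') (Suc (i + w))"
        using agree[OF R, of n] w mn by simp
      ultimately have "M * e + c = M * e' + c'" by simp
      moreover have "c < M * T" "c' < M * T" using R MT by (auto simp: Q_def)
      ultimately have "c = c'" using same_residue_same_class[OF M_pos] cls by blast
      with v \<open>M * e + c = M * e' + c'\<close> show ?thesis by simp
    qed
    \<comment> \<open>Once \<open>a\<close> is known as well, the common vertex in layer
      \<open>n\<close> determines \<open>x\<close> and \<open>y\<close>.\<close>
    have "inj_on speed ?R"
    proof (rule inj_onI)
      fix \<tau> \<tau>' assume R: "\<tau> \<in> ?R" "\<tau>' \<in> ?R" and "speed \<tau> = speed \<tau>'"
      obtain x e y a c j where \<tau>: "\<tau> = (x, e, y, a, c, j)" by (cases \<tau>)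
      obtain x' e' y' c' j' where \<tau>': "\<tau>' = (x', e', y', a, c', j')"
        using \<open>speed \<tau> = speed \<tau>'\<close> by (cases \<tau>') (auto simp: \<tau> speed_def)
      have "path \<tau> (Suc (i + w)) = path \<tau>' (Suc (i + w))"
        using agree[OF R, of n] w mn by simp
      with eq_c[OF R[unfolded \<tau> \<tau>']] M_pos show "\<tau> = \<tau>'" by (simp add: \<tau> \<tau>')
    qed
    then have "card ?R = card (speed ` ?R)" by (simp add: card_image)
    moreover have "card (speed ` ?R) * w \<le> 9 * N"
    proof (rule card_unseparated_le[OF _ w(1,3)])
      show "speed ` ?R \<subseteq> {..N}" by (auto simp: speed_def Q_def)
      fix a a' k assume a: "a \<in> speed ` ?R" "a' \<in> speed ` ?R" and k: "k \<in> {i..<i + w}"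
      obtain \<tau> \<tau>' where \<tau>: "\<tau> \<in> ?R" "\<tau>' \<in> ?R" "a = speed \<tau>" "a' = speed \<tau>'" using a by blast
      obtain x e y b1 c j where 1: "\<tau> = (x, e, y, b1, c, j)" by (cases \<tau>)
      obtain x' e' y' b2 c' j' where 2: "\<tau>' = (x', e', y', b2, c', j')" by (cases \<tau>')
      have "a = b1" "a' = b2" using \<tau> by (auto simp: 1 2 speed_def)
      with same[OF \<tau>(1,2)[unfolded 1 2] k] show "bit_rev b k < a \<longleftrightarrow> bit_rev b k < a'"
        by (auto simp: w1_def)
    qed
    ultimately have "card ?R * w \<le> 9 * N" by simp
    moreover have "card ?R * (n - m) \<le> card ?R * (2 * w)"
      using w by (intro mult_left_mono) auto
    ultimately show ?thesis unfolding m_def n_def by linarith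
  next
    case True
    show ?thesis unfolding True by simp
  qed
qed

section \<open>Cardinalities and the resulting bound on the number of shortcuts\<close>

lemma card_sources: "card sources = T * N ^ 3"
proof -
  have "inj_on (\<lambda>(x, e, y). (0, x, M * e, y, 0) :: vert) ({..<N} \<times> {..<T} \<times> {..<N ^ 2})"
    using M_pos by (auto simp: inj_on_def)
  then show ?thesis by (simp add: sources_def card_image card_cartesian_product power_numeral_reduce)
qed

lemma card_inner: "card inner = 36 * (N + 1) * N ^ 4 * J"
  by (simp add: inner_def card_cartesian_product power_numeral_reduce algebra_simps)

lemma card_Q: "card Q = T * N ^ 5 * J"
  by (simp add: Q_def card_cartesian_product power_numeral_reduce)

lemma card_inner_le: "card inner \<le> 72 * N ^ 5 * J"
proof -
  have "36 * (N + 1) * N ^ 4 * J \<le> 36 * (2 * N) * N ^ 4 * J"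
    by (intro mult_right_mono mult_left_mono) auto
  then show ?thesis by (simp add: card_inner power_numeral_reduce)
qed

lemma card_verts: "card (pverts G) = card V"
  by (simp add: G_def card_image)

lemma card_verts_ge: "N ^ 5 * J \<le> card (pverts G)"
proof -
  have "1 * N * N ^ 4 * J \<le> 36 * (N + 1) * N ^ 4 * J"
    by (intro mult_right_mono mult_mono) auto
  also have "\<dots> \<le> card V"
    unfolding card_inner[symmetric] by (rule card_mono) (auto simp: V_def)
  finally show ?thesis by (simp add: card_verts power_numeral_reduce)
qed

lemma T_le_N: "T \<le> N"
  using M_pos by (simp add: MT)

lemma card_verts_le: "card (pverts G) \<le> 73 * N ^ 5 * J"
proof -
  have "T * N ^ 3 * 1 \<le> (N * N) * N ^ 3 * J"
    using T_le_N J_pos by (intro mult_mono) (auto intro: order_trans)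
  then have "card sources \<le> N ^ 5 * J" by (simp add: card_sources power_numeral_reduce)
  moreover have "card V \<le> card sources + card inner" unfolding V_def by (rule card_Un_le)
  ultimately show ?thesis using card_inner_le unfolding card_verts by linarith
qed

text \<open>The fan contributes \<open>T * N ^ 4 * J \<le> N ^ 5 * J\<close> arcs and each inner
  vertex at most four moves, whence \<open>289 = 1 + 4 * 72\<close>. The constant is free of
  \<open>T\<close>, so \<open>T\<close> can be chosen large in terms of \<open>C\<close>.\<close>

lemma card_arcs_le: "card (parcs G) \<le> 289 * N ^ 5 * J"
proof -
  have card_bools: "card (UNIV :: (bool \<times> bool) set) = 4"
    unfolding UNIV_Times_UNIV[symmetric] card_cartesian_product by simp
  have "card (parcs G) \<le> card E" by (simp add: G_def card_image_le)
  also have "\<dots> \<le> card (fan ` (sources \<times> {..<N} \<times> {..<J}) \<union> move ` (inner \<times> UNIV))"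
    unfolding E_def by (intro card_mono) auto
  also have "\<dots> \<le> card (fan ` (sources \<times> {..<N} \<times> {..<J})) + card (move ` (inner \<times> UNIV))"
    by (rule card_Un_le)
  also have "\<dots> \<le> card (sources \<times> {..<N} \<times> {..<J}) + card (inner \<times> (UNIV :: (bool \<times> bool) set))"
    by (intro add_mono card_image_le) auto
  also have "\<dots> = T * (N ^ 4 * J) + 4 * card inner"
    by (simp add: card_cartesian_product card_sources power_numeral_reduce card_bools)
  also have "T * (N ^ 4 * J) \<le> N * (N ^ 4 * J)"
    using T_le_N by (rule mult_right_mono) simp
  finally show ?thesis using card_inner_le by (simp add: power_numeral_reduce)
qed

lemma card_encoded_sources: "card (to_nat ` sources) = T * N ^ 3"
  by (simp add: card_image card_sources)

lemma encoded_sources_subset: "to_nat ` sources \<subseteq> pverts G"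
  by (auto simp: G_def V_def)

text \<open>This is the double counting with \<open>K = T + 1\<close> and \<open>W = 18 * N\<close>;
  a factor \<open>N\<close> cancels.\<close>

lemma shortcuts_bound:
  assumes H: "shortcut_set G H" and q: "2 * real (T + 1) * q \<le> real N"
    and diam: "sourcewise_diameter (add_arcs G H) (to_nat ` sources) < ereal q"
  shows "T * N ^ 5 * J \<le> 36 * card H"
proof -
  have "card Q * (N + 1) \<le> 2 * card H * (18 * N)"
  proof (rule shortcuts_needed[OF H _ _ long_shortcut_on_few_paths diam])
    show "2 * real (T + 1) * q \<le> real (N + 1)" using q by simp
  qed (auto simp: path_0_sources simp del: path.simps)
  moreover have "card Q * N \<le> card Q * (N + 1)" by simp
  ultimately have "card Q * N \<le> 36 * card H * N" by linarith
  then show ?thesis by (simp add: card_Q)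
qed

end

section \<open>The lower bound\<close>

theorem theorem6p1:
  fixes d :: nat and C :: real
  assumes "d \<ge> 2" and "C > 0"
  shows "\<exists>c>0. \<exists>A>0. \<exists>k::nat. infinite {n::nat. n > 0 \<and>
    (\<exists>(G :: nat pair_pre_digraph) S.
      pair_digraph G \<and> card (pverts G) = n \<and> S \<subseteq> pverts G \<and>
      real n powr (3 / (real d + 3)) / (A * ln (real n) ^ k) \<le> real (card S) \<and>
      real (card S) \<le> real n powr (3 / (real d + 3)) * (A * ln (real n) ^ k) \<and>
      (\<forall>H. shortcut_set G H \<and> real (card H) \<le> C * real n \<longrightarrow>
        sourcewise_diameter (add_arcs G H) S \<ge> ereal (c * real n powr (1 / (real d + 3)))) \<and>
      (\<forall>H. shortcut_set G H \<and> real (card H) \<le> C * real (card (parcs G)) \<longrightarrow>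
        sourcewise_diameter (add_arcs G H) S \<ge> ereal (c * real n powr (1 / (real d + 3)))))}"
proof -
  \<comment> \<open>Here \<open>10404 = 36 * 289\<close>, from the bounds on shortcuts and arcs. A
    power of two is taken so that \<open>T\<close> divides \<open>N\<close>.\<close>
  obtain t where t: "10404 * C < 2 ^ t"
    using real_arch_pow[of 2 "10404 * C"] by auto
  define T :: nat where "T = 2 ^ t"
  \<comment> \<open>With \<open>146 = 2 * 73\<close> the bound \<open>r \<le> 73 * N\<close> below
    gives \<open>2 * (T + 1) * (c * r) \<le> N\<close>.\<close>
  define c where "c = 1 / (146 * (real T + 1))"
  \<comment> \<open>The summand \<open>73 ^ 3\<close> serves the lower bound on the number of
    sources and \<open>T\<close> the upper one; no logarithms occur, so the exponent is 0.\<close>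
  define A where "A = 73 ^ 3 + real T"
  define P where "P n \<longleftrightarrow> n > 0 \<and>
    (\<exists>(G :: nat pair_pre_digraph) S.
      pair_digraph G \<and> card (pverts G) = n \<and> S \<subseteq> pverts G \<and>
      real n powr (3 / (real d + 3)) / (A * ln (real n) ^ 0) \<le> real (card S) \<and>
      real (card S) \<le> real n powr (3 / (real d + 3)) * (A * ln (real n) ^ 0) \<and>
      (\<forall>H. shortcut_set G H \<and> real (card H) \<le> C * real n \<longrightarrow>
        sourcewise_diameter (add_arcs G H) S \<ge> ereal (c * real n powr (1 / (real d + 3)))) \<and>
      (\<forall>H. shortcut_set G H \<and> real (card H) \<le> C * real (card (parcs G)) \<longrightarrow>
        sourcewise_diameter (add_arcs G H) S \<ge> ereal (c * real n powr (1 / (real d + 3)))))"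
    for n :: nat
  \<comment> \<open>Each large \<open>b\<close> yields a graph with more than \<open>b\<close>
    vertices, which gives infinitely many \<open>n\<close>.\<close>
  have "\<exists>n > b. P n" if "t \<le> b" for b
  proof -
    interpret layered_graph b "2 ^ (b - t)" T "(2 ^ b) ^ (d - 2)"
      by unfold_locales (use that in \<open>simp_all add: T_def flip: power_add\<close>)
    let ?N = "2 ^ b :: nat"
    define n where "n = card (pverts G)"
    define r where "r = real n powr (1 / (real d + 3))"
    have "5 + (d - 2) = d + 3" using \<open>d \<ge> 2\<close> by simp
    then have size: "?N ^ 5 * ?N ^ (d - 2) = ?N ^ (d + 3)"
      by (metis power_add)
    have "b < ?N" by simp
    also have "?N \<le> ?N ^ (d + 3)" by (rule self_le_power) auto
    also have n_ge: "?N ^ (d + 3) \<le> n"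
      using card_verts_ge size by (simp add: n_def)
    finally have "b < n" .
    have n_le: "n \<le> 73 * ?N ^ (d + 3)"
      using card_verts_le size by (simp add: n_def mult.assoc)
    have m_le: "card (parcs G) \<le> 289 * ?N ^ (d + 3)"
      using card_arcs_le size by (simp add: mult.assoc)
    have root: "(x ^ (d + 3)) powr (1 / (real d + 3)) = x" if "x > 0" for x :: real
      using that by (simp add: powr_powr flip: powr_realpow)
    have r_ge: "real ?N \<le> r"
    proof -
      have "real ?N ^ (d + 3) \<le> real n" using n_ge by (metis of_nat_le_iff of_nat_power)
      then have "(real ?N ^ (d + 3)) powr (1 / (real d + 3)) \<le> r"
        unfolding r_def by (intro powr_mono2) auto
      then show ?thesis using root[of "real ?N"] by simp
    qed
    have r_le: "r \<le> 73 * real ?N"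
    proof -
      have "real n \<le> 73 * real ?N ^ (d + 3)"
        using n_le by (metis (mono_tags, lifting) of_nat_le_iff of_nat_mult of_nat_numeral of_nat_power)
      also have "\<dots> \<le> 73 ^ (d + 3) * real ?N ^ (d + 3)"
        by (intro mult_right_mono self_le_power) auto
      also have "\<dots> = (73 * real ?N) ^ (d + 3)" by (simp only: power_mult_distrib)
      finally have "r \<le> ((73 * real ?N) ^ (d + 3)) powr (1 / (real d + 3))"
        unfolding r_def by (intro powr_mono2) auto
      then show ?thesis using root[of "73 * real ?N"] by simp
    qed
    have r3: "real n powr (3 / (real d + 3)) = r ^ 3"
      using \<open>b < n\<close> unfolding r_def by (subst powr_power) auto
    have S: "real (card (to_nat ` sources)) = real T * real ?N ^ 3"
      by (simp add: card_encoded_sources)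
    have T1: "real T \<ge> 1" using T_pos by simp
    have "r ^ 3 \<le> (73 * real ?N) ^ 3" using r_le r_ge by (intro power_mono) auto
    also have "\<dots> = 73 ^ 3 * real ?N ^ 3" by (simp only: power_mult_distrib)
    also have "\<dots> \<le> A * (real T * real ?N ^ 3)"
    proof -
      have "73 ^ 3 * 1 \<le> A * real T" using T1 by (intro mult_mono) (auto simp: A_def)
      then have "73 ^ 3 * 1 * real ?N ^ 3 \<le> A * real T * real ?N ^ 3"
        by (rule mult_right_mono) simp
      then show ?thesis by (simp add: mult.assoc)
    qed
    finally have S_ge: "r ^ 3 / A \<le> real (card (to_nat ` sources))"
      unfolding S using T1 by (simp add: A_def divide_le_eq mult.commute)
    have "real T * real ?N ^ 3 \<le> A * r ^ 3"
      using r_ge T1 by (intro mult_mono power_mono) (auto simp: A_def)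
    then have S_le: "real (card (to_nat ` sources)) \<le> r ^ 3 * A"
      unfolding S by (simp add: mult.commute)
    \<comment> \<open>Stated for any \<open>m\<close> up to the arc bound, this covers both the
      number of vertices and the number of arcs.\<close>
    have diam: "sourcewise_diameter (add_arcs G H) (to_nat ` sources) \<ge> ereal (c * r)"
      if H: "shortcut_set G H" and "real (card H) \<le> C * real m" "m \<le> 289 * ?N ^ (d + 3)" for H m
    proof (rule ccontr)
      assume "\<not> ?thesis"
      then have less: "sourcewise_diameter (add_arcs G H) (to_nat ` sources) < ereal (c * r)" by simp
      have "2 * real (T + 1) * (c * r) = r / 73"
        using T1 by (simp add: c_def field_simps)
      then have "2 * real (T + 1) * (c * r) \<le> real ?N" using r_le by linarith
      then have "T * ?N ^ 5 * ?N ^ (d - 2) \<le> 36 * card H"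
        by (rule shortcuts_bound[OF H _ less])
      then have "T * ?N ^ (d + 3) \<le> 36 * card H" using size by (simp add: mult.assoc)
      then have "real (T * ?N ^ (d + 3)) \<le> real (36 * card H)" by (simp only: of_nat_le_iff)
      also have "\<dots> \<le> 36 * (C * real m)" using that by simp
      also have "\<dots> \<le> 36 * (C * real (289 * ?N ^ (d + 3)))"
      proof -
        have "real m \<le> real (289 * ?N ^ (d + 3))" using that(3) by (simp only: of_nat_le_iff)
        then show ?thesis using \<open>C > 0\<close> by (intro mult_left_mono) simp_all
      qed
      finally have "real T * real (?N ^ (d + 3)) \<le> (10404 * C) * real (?N ^ (d + 3))" by simp
      then have "real T \<le> 10404 * C"
        by (subst (asm) mult_le_cancel_right_pos) simp_all
      with t show False by (simp add: T_def)
    qed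
    have "P n"
      unfolding P_def r3 r_def[symmetric] power_0 mult_1_right
    proof (intro conjI exI allI impI; (elim conjE)?)
      show "n > 0" using \<open>b < n\<close> by simp
      show "pair_digraph G" by (rule pair_digraph_axioms)
      show "card (pverts G) = n" by (simp add: n_def)
      show "to_nat ` sources \<subseteq> pverts G" by (rule encoded_sources_subset)
      show "r ^ 3 / A \<le> real (card (to_nat ` sources))" by (rule S_ge)
      show "real (card (to_nat ` sources)) \<le> r ^ 3 * A" by (rule S_le)
      show "ereal (c * r) \<le> sourcewise_diameter (add_arcs G H) (to_nat ` sources)"
        if "shortcut_set G H" "real (card H) \<le> C * real n" for H
        using diam[OF that] n_le by simp
      show "ereal (c * r) \<le> sourcewise_diameter (add_arcs G H) (to_nat ` sources)"
        if "shortcut_set G H" "real (card H) \<le> C * real (card (parcs G))" for H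
        using diam[OF that] m_le by simp
    qed
    with \<open>b < n\<close> show ?thesis by blast
  qed
  then have "infinite {n. P n}"
    unfolding infinite_nat_iff_unbounded by (metis max.cobounded1 max.cobounded2 mem_Collect_eq order_le_less_trans)
  moreover have "c > 0" "A > 0" by (simp_all add: c_def A_def add_nonneg_pos add_pos_nonneg)
  ultimately show ?thesis
    unfolding P_def by (intro exI[of _ c] exI[of _ A] exI[of _ 0] conjI)
qed

end
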